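(* For $a,b\in\mathbb{N}$, the minimum rank of the Hopi rectangle graph $HD(a,b)$ of order $(a,b)$ is bounded above by $2ab$, i.e. $\operatorname{mr}(HD(a,b))\le 2ab$. Moreover, the maximum nullity of $HD(a,b)$ is bounded below by $a+b$, i.e. $M(HD(a,b))\ge a+b$.
   Context: All graphs are finite, simple and undirected; $\mathbb{N}$ denotes the positive integers. Hopi rectangle graph: for $a,b\in\mathbb{N}$, view the vertices of the grid graph $P_{a+b}\square P_{a+b}$ as the integer pairs $(i,j)$ with $0\le i,j\le a+b-1$, two pairs being adjacent iff they differ by $\pm(1,0)$ or $\pm(0,1)$. The Hopi rectangle graph $HD(a,b)$ of order $(a,b)$ is the subgraph of $P_{a+b}\square P_{a+b}$ induced by the vertex set $$\{(i,j): a-1\le i+j\le 2b+a-1 \text{ and } |i-j|\le a\}.$$ For a graph $G$ on $n$ vertices (labelled $1,\dots,n$), $\mathcal{S}(G)$ is the set of real symmetric $n\times n$ matrices $A=(a_{i,j})$ such that for all $i\neq j$, $a_{i,j}\neq0$ iff $ij\in E(G)$ (diagonal entries are unrestricted). The minimum rank is $\operatorname{mr}(G)=\min\{\operatorname{rank}(A):A\in\mathcal{S}(G)\}$ and the maximum nullity is $M(G)=\max\{\operatorname{null}(A):A\in\mathcal{S}(G)\}$. *)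

theory Defs
  imports
    "Jordan_Normal_Form.DL_Rank"
    "Jordan_Normal_Form.Matrix_Kernel"
    "Graph_Theory.Graph_Theory"
    "HOL-Library.Product_Plus"
begin

text \<open>
  As in \<^theory>\<open>Graph_Theory.Digraph\<close>, an undirected graph is a symmetric digraph; a finite
  simple graph is one satisfying the locale predicate \<^const>\<open>graph\<close>.
\<close>

definition square_grid :: "nat \<Rightarrow> (int \<times> int) pair_pre_digraph" where
  "square_grid n =
    (let V = {0..<int n} \<times> {0..<int n} in
      \<lparr> pverts = V,
        parcs = {(p, q). p \<in> V \<and> q \<in> V \<and> p - q \<in> {(1, 0), (-1, 0), (0, 1), (0, -1)}} \<rparr>)"

definition hopi_rectangle :: "nat \<Rightarrow> nat \<Rightarrow> (int \<times> int, (int \<times> int) \<times> (int \<times> int)) pre_digraph" where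
  "hopi_rectangle a b =
    with_proj (square_grid (a + b)) \<restriction>
      {(i, j) \<in> pverts (square_grid (a + b)).
        int a - 1 \<le> i + j \<and> i + j \<le> 2 * int b + int a - 1 \<and> \<bar>i - j\<bar> \<le> int a}"

definition vertex_labelling :: "('v, 'e) pre_digraph \<Rightarrow> (nat \<Rightarrow> 'v) \<Rightarrow> bool" where
  "vertex_labelling G l \<longleftrightarrow> bij_betw l {0..<card (verts G)} (verts G)"

text \<open>
  Matrix indices start at 0, so a graph on n vertices is labelled by 0, ..., n - 1.
  The matrices, the minimum rank and the maximum nullity take the labelling as a parameter.
\<close>

definition sym_matrices :: "('v, 'e) pre_digraph \<Rightarrow> (nat \<Rightarrow> 'v) \<Rightarrow> real mat set" where
  "sym_matrices G l =
    {A \<in> carrier_mat (card (verts G)) (card (verts G)).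
      transpose_mat A = A \<and>
      (\<forall>i < card (verts G). \<forall>j < card (verts G).
        i \<noteq> j \<longrightarrow> (A $$ (i, j) \<noteq> 0 \<longleftrightarrow> l i \<rightarrow>\<^bsub>G\<^esub> l j))}"

definition min_rank :: "('v, 'e) pre_digraph \<Rightarrow> (nat \<Rightarrow> 'v) \<Rightarrow> nat" where
  "min_rank G l = Min (vec_space.rank (card (verts G)) ` sym_matrices G l)"

definition max_nullity :: "('v, 'e) pre_digraph \<Rightarrow> (nat \<Rightarrow> 'v) \<Rightarrow> nat" where
  "max_nullity G l = Max (kernel_dim ` sym_matrices G l)"

text \<open>The minimum and the maximum range over finite nonempty sets.\<close>

lemma finite_ranks: "finite (vec_space.rank (card (verts G)) ` sym_matrices G l)"
proof (rule finite_subset)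
  show "vec_space.rank (card (verts G)) ` sym_matrices G l \<subseteq> {..card (verts G)}"
    by (auto simp: sym_matrices_def intro: vec_space.rank_le_nc)
qed simp

lemma finite_nullities: "finite (kernel_dim ` sym_matrices G l)"
proof (rule finite_subset)
  show "kernel_dim ` sym_matrices G l \<subseteq> {..card (verts G)}"
    by (auto simp: sym_matrices_def kernel_dim_code)
qed simp

lemma sym_matrices_nonempty:
  assumes "graph G"
  shows "sym_matrices G l \<noteq> {}"
proof -
  interpret graph G by fact
  have "mat (card (verts G)) (card (verts G)) (\<lambda>(i, j). if l i \<rightarrow>\<^bsub>G\<^esub> l j then 1 else 0)
      \<in> sym_matrices G l"
    using arcs_ends_symmetric[OF sym_arcs] by (auto simp: sym_matrices_def)
  then show ?thesis by blast
qed

lemma vertex_labelling_exists: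
  assumes "graph G"
  shows "\<exists>l. vertex_labelling G l"
proof -
  interpret graph G by fact
  show ?thesis
    unfolding vertex_labelling_def by (rule ex_bij_betw_nat_finite) simp
qed

lemma graph_hopi_rectangle: "graph (hopi_rectangle a b)"
proof -
  let ?G = "hopi_rectangle a b"
  let ?H = "square_grid (a + b)"
  have verts: "verts ?G \<subseteq> pverts ?H"
    and arcs: "arcs ?G = {e \<in> parcs ?H. fst e \<in> verts ?G \<and> snd e \<in> verts ?G}"
    and ends: "tail ?G = fst" "head ?G = snd"
    by (auto simp: hopi_rectangle_def)
  have fin: "finite (verts ?G)"
    using verts by (rule finite_subset) (simp add: square_grid_def Let_def)
  have "arcs ?G \<subseteq> verts ?G \<times> verts ?G"
    unfolding arcs by auto
  then have fin': "finite (arcs ?G)"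
    using fin by (simp add: finite_subset)
  have loop: "(p, p) \<notin> parcs ?H" for p
    by (simp add: square_grid_def Let_def zero_prod_def)
  have sym: "(q, p) \<in> parcs ?H" if "(p, q) \<in> parcs ?H" for p q
  proof -
    have "p - q \<in> {(1, 0), (-1, 0), (0, 1), (0, -1)}"
      using that by (simp add: square_grid_def Let_def)
    then have "- (p - q) \<in> {(1, 0), (-1, 0), (0, 1), (0, -1)}"
      by (elim insertE emptyE; simp only:; simp)
    then show ?thesis
      using that by (simp add: square_grid_def Let_def)
  qed
  show ?thesis
  proof unfold_locales
    show "finite (verts ?G)" "finite (arcs ?G)" by fact+
    show "tail ?G e \<in> verts ?G" "head ?G e \<in> verts ?G" if "e \<in> arcs ?G" for e
      using that by (simp_all add: arcs ends)
    show "tail ?G e \<noteq> head ?G e" if "e \<in> arcs ?G" for e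
      using that loop by (cases e) (auto simp: arcs ends)
    show "e = e'" if "arc_to_ends ?G e = arc_to_ends ?G e'" for e e'
      using that by (simp add: arc_to_ends_def ends prod_eq_iff)
    show "symmetric ?G"
      unfolding symmetric_def arcs_ends_def arc_to_ends_def ends arcs
      by (rule symI) (auto intro: sym)
  qed
qed

end

theory Submission
  imports Defs
begin

text \<open>
  Colour the unit squares of the grid like a chessboard. The squares of one colour inside the Hopi
  rectangle partition its edges into \<open>a * b\<close> four-cycles.
  A four-cycle is a complete bipartite graph with both parts of size 2, so its adjacency matrix
  has rank 2; the sum of these matrices lies in \<open>\<S>(HD(a,b))\<close> and has rank at most
  \<open>2 * a * b\<close>. As the graph has \<open>2 * a * b + a + b\<close> vertices, the bound on the nullity follows
  from the rank-nullity theorem.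
\<close>

text \<open>This is the rank-nullity theorem for the linear map
  \<open>\<lambda>v. A *\<^sub>v v\<close>: its image is the column space, whose dimension is
  \<open>rank A\<close>, and its kernel is \<open>mat_kernel A\<close>.\<close>

lemma (in vec_space) rank_plus_kernel_dim:
  assumes A: "A \<in> carrier_mat n nc"
  shows "rank A + kernel_dim A = nc"
proof -
  let ?W = "module_vec TYPE('a) nc"
  interpret K: kernel n nc A by unfold_locales (rule A)
  have hom: "(\<lambda>v. A *\<^sub>v v) \<in> LinearCombinations.module_hom class_ring ?W V"
    unfolding LinearCombinations.module_hom_def using A
    by (simp add: class_ring_simps module_vec_def mult_add_distrib_mat_vec mult_mat_vec)
  interpret L: linear_map class_ring ?W V "\<lambda>v. A *\<^sub>v v"
    by (intro linear_map.intro mod_hom.intro mod_hom_axioms.intro hom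
      vectorspace_axioms K.NC.vectorspace_axioms module_axioms K.NC.module_axioms)
  have "L.im = {y \<in> carrier_vec n. \<exists>x\<in>carrier_vec nc. A *\<^sub>v x = y}"
    using A unfolding L.im_def by (auto simp: module_vec_def)
  then have im: "L.im = span (set (cols A))"
    using col_space_eq[OF A] A unfolding col_space_def by simp
  have ker: "L.ker = mat_kernel A"
    using A unfolding L.ker_def mat_kernel_def by (simp add: module_vec_def)
  show ?thesis
    using L.rank_nullity[OF K.NC.fin_dim]
    unfolding im ker rank_def K.kernel_dim K.NC.dim_is_n .
qed

text \<open>Each summand is an outer product, hence of rank at most 1, and rank is
  subadditive.\<close>

lemma (in vec_space) rank_sum_products_le:
  fixes f g :: "'k \<Rightarrow> nat \<Rightarrow> 'a"
  assumes "finite K"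
  shows "rank (mat n nc (\<lambda>(i, j). \<Sum>k\<in>K. f k i * g k j)) \<le> card K"
  using assms
proof (induction K rule: finite_induct)
  case empty
  have "mat n nc (\<lambda>(i, j). \<Sum>k\<in>{}. f k i * g k j) = 0\<^sub>m n nc"
    by (rule eq_matI) auto
  then show ?case by (simp only: rank_0I le0)
next
  case (insert k K)
  let ?P = "mat n nc (\<lambda>(i, j). f k i * g k j)"
  let ?Q = "mat n nc (\<lambda>(i, j). \<Sum>k\<in>K. f k i * g k j)"
  have "mat n nc (\<lambda>(i, j). \<Sum>k\<in>insert k K. f k i * g k j) = ?P + ?Q"
    using insert.hyps by (intro eq_matI) auto
  moreover have "rank (?P + ?Q) \<le> rank ?P + rank ?Q"
    by (rule rank_subadditive) auto
  moreover have "rank ?P \<le> 1"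
    by (rule rank_le_1_product_entries) auto
  ultimately show ?case using insert by simp
qed

text \<open>Adding the bounds on \<open>i + j\<close> and \<open>i - j\<close> gives -1 \<le> 2i
  \<le> 2(a + b) - 1, and likewise for \<open>j\<close>; by integrality such points lie in the
  grid.\<close>

lemma verts_hopi_rectangle:
  "verts (hopi_rectangle a b) =
    {(i, j). int a - 1 \<le> i + j \<and> i + j \<le> 2 * int b + int a - 1 \<and> \<bar>i - j\<bar> \<le> int a}"
  by (auto simp: hopi_rectangle_def square_grid_def Let_def)

lemma arcs_ends_hopi_rectangle:
  "p \<rightarrow>\<^bsub>hopi_rectangle a b\<^esub> q \<longleftrightarrow>
    p \<in> verts (hopi_rectangle a b) \<and> q \<in> verts (hopi_rectangle a b) \<and>
    p - q \<in> {(1, 0), (-1, 0), (0, 1), (0, -1)}"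
  by (auto simp: hopi_rectangle_def square_grid_def Let_def arcs_ends_def arc_to_ends_def image_iff)

text \<open>
  In the rotated coordinates \<open>i + j\<close> and \<open>i - j\<close> the squares of this colour inside \<open>HD(a,b)\<close>
  form a \<open>b\<close> by \<open>a\<close> array, indexed by \<open>(s, t)\<close>. The parts of the four-cycle of a square are its two
  pairs of opposite corners.
\<close>

definition diag :: "nat \<Rightarrow> nat \<times> nat \<Rightarrow> (int \<times> int) set" where
  "diag a = (\<lambda>(s, t). let i = int s + int t; j = int s - int t + int a - 1
    in {(i, j), (i + 1, j + 1)})"

definition antidiag :: "nat \<Rightarrow> nat \<times> nat \<Rightarrow> (int \<times> int) set" where
  "antidiag a = (\<lambda>(s, t). let i = int s + int t; j = int s - int t + int a - 1
    in {(i + 1, j), (i, j + 1)})"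

text \<open>The parity of \<open>i + j - int a\<close> splits the vertices into two arrays in
  rotated coordinates: the odd class \<open>?X\<close> has \<open>(b + 1) * a\<close> points, the
  even class \<open>?Y\<close> has \<open>b * (a + 1)\<close>.\<close>

lemma card_verts_hopi_rectangle: "card (verts (hopi_rectangle a b)) = 2 * a * b + a + b"
proof -
  let ?f = "\<lambda>(s, t). (int s + int t, int s - int t + int a - 1)"
  let ?g = "\<lambda>(s, t). (int s + int t, int s - int t + int a)"
  let ?X = "?f ` ({..b} \<times> {..<a})" and ?Y = "?g ` ({..<b} \<times> {..a})"
  have "p \<in> ?X \<union> ?Y" if "p \<in> verts (hopi_rectangle a b)" for p
  proof -
    obtain i j where p: "p = (i, j)" by fastforce
    have v: "int a - 1 \<le> i + j" "i + j \<le> 2 * int b + int a - 1" "\<bar>i - j\<bar> \<le> int a"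
      using that by (auto simp: p verts_hopi_rectangle)
    show ?thesis
    proof (cases "even (i + j - int a)")
      case True
      then obtain s where s: "i + j - int a = 2 * s" by (elim evenE)
      \<comment> \<open>Solving for \<open>t\<close> gives \<open>t = i - s\<close>, so that 2t = i
        - j + a lies between 0 and 2a, while 2s lies between -1 and 2b - 1; hence \<open>nat\<close>
        changes neither value.\<close>
      have "p = ?g (nat s, nat (i - s))" "nat s < b" "nat (i - s) \<le> a"
        using s v by (auto simp: p)
      then show ?thesis by blast
    next
      case False
      then have "even (i + j - int a + 1)" by simp
      then obtain s where "i + j - int a + 1 = 2 * s" by (elim evenE)
      then have s: "i + j - int a = 2 * s - 1" by simp
      have "p = ?f (nat s, nat (i - s))" "nat s \<le> b" "nat (i - s) < a"
        using s v by (auto simp: p)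
      then show ?thesis by blast
    qed
  qed
  moreover have "?X \<union> ?Y \<subseteq> verts (hopi_rectangle a b)"
    by (auto simp: verts_hopi_rectangle)
  ultimately have "verts (hopi_rectangle a b) = ?X \<union> ?Y" by blast
  moreover have "?X \<inter> ?Y = {}"
  proof -
    have "p \<notin> ?Y" if "p \<in> ?X" for p
    proof -
      from that have "odd (fst p + snd p - int a)" by auto
      then show ?thesis by auto
    qed
    then show ?thesis by blast
  qed
  moreover have "card ?X = (b + 1) * a" "card ?Y = b * (a + 1)"
    by (subst card_image; auto simp: inj_on_def card_cartesian_product)+
  ultimately show ?thesis by (simp add: card_Un_disjoint algebra_simps)
qed

lemma hopi_rectangle_square_adj:
  assumes "k \<in> {..<b} \<times> {..<a}" "p \<in> diag a k" "q \<in> antidiag a k"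
  shows "p \<rightarrow>\<^bsub>hopi_rectangle a b\<^esub> q"
  using assms by (auto simp: arcs_ends_hopi_rectangle verts_hopi_rectangle diag_def antidiag_def Let_def)

text \<open>The odd endpoint of an edge is a diagonal corner of the wanted square, and the direction
  of the edge decides which of the two.\<close>

lemma hopi_rectangle_adj_square:
  assumes adj: "(i, j) \<rightarrow>\<^bsub>hopi_rectangle a b\<^esub> q" and par: "odd (i + j - int a)"
  shows "\<exists>k \<in> {..<b} \<times> {..<a}. (i, j) \<in> diag a k \<and> q \<in> antidiag a k"
proof -
  obtain i' j' where q: "q = (i', j')" by fastforce
  have v: "\<bar>i - j\<bar> \<le> int a" "int a - 1 \<le> i' + j'" "i' + j' \<le> 2 * int b + int a - 1"
    and q': "i' = i - 1 \<and> j' = j \<or> i' = i + 1 \<and> j' = j \<or> i' = i \<and> j' = j - 1 \<or> i' = i \<and> j' = j + 1"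
    using adj by (auto simp: q arcs_ends_hopi_rectangle verts_hopi_rectangle)
  from par obtain r where r: "i + j - int a = 2 * r + 1" by (elim oddE)
  \<comment> \<open>\<open>(x, y)\<close> is the lower left corner of the square: it is
    \<open>(i, j)\<close> itself if \<open>q\<close> has the larger coordinate sum, and otherwise
    \<open>(i, j)\<close> is the upper right corner.\<close>
  define x y where "x = (if i' + j' > i + j then i else i - 1)"
    and "y = (if i' + j' > i + j then j else j - 1)"
  define s where "s = (if i' + j' > i + j then r + 1 else r)"
  \<comment> \<open>In both cases \<open>i' + j' = 2 * s + int a\<close>, so the bounds on
    \<open>q\<close> confine \<open>s\<close>.\<close>
  have xy: "x + y - int a = 2 * s - 1" "0 \<le> s" "s < int b"
    using q' r v by (auto simp: x_def y_def s_def)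
  \<comment> \<open>By parity \<open>i - j\<close> misses both extremes; the resulting strict bound
    yields 0 \<le> t < a for \<open>t = x - s\<close>, as 2t = x - y + a - 1.\<close>
  have "i - j \<noteq> int a" "i - j \<noteq> - int a"
    using r by presburger+
  then have d: "\<bar>x - y\<bar> < int a"
    using v by (auto simp: x_def y_def)
  have st: "int (nat s) = s" "int (nat (x - s)) = x - s" "s - (x - s) + int a - 1 = y"
    using xy d by auto
  show ?thesis
  proof (rule bexI)
    show "(nat s, nat (x - s)) \<in> {..<b} \<times> {..<a}"
      using xy d by auto
    have "diag a (nat s, nat (x - s)) = {(x, y), (x + 1, y + 1)}"
      and "antidiag a (nat s, nat (x - s)) = {(x + 1, y), (x, y + 1)}"
      unfolding diag_def antidiag_def Let_def prod.case st by simp_all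
    then show "(i, j) \<in> diag a (nat s, nat (x - s)) \<and> q \<in> antidiag a (nat s, nat (x - s))"
      using q' by (auto simp: q x_def y_def)
  qed
qed

lemma hopi_rectangle_adj_iff_square:
  "p \<rightarrow>\<^bsub>hopi_rectangle a b\<^esub> q \<longleftrightarrow> (\<exists>k \<in> {..<b} \<times> {..<a}.
    p \<in> diag a k \<and> q \<in> antidiag a k \<or> q \<in> diag a k \<and> p \<in> antidiag a k)"
proof
  interpret graph "hopi_rectangle a b" by (rule graph_hopi_rectangle)
  assume adj: "p \<rightarrow>\<^bsub>hopi_rectangle a b\<^esub> q"
  then have adj': "q \<rightarrow>\<^bsub>hopi_rectangle a b\<^esub> p"
    by (rule arcs_ends_symmetric[OF sym_arcs])
  obtain i j i' j' where pq: "p = (i, j)" "q = (i', j')" by fastforce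
  \<comment> \<open>An edge changes the coordinate sum by 1, so one of its endpoints has the parity
    of the diagonal corners.\<close>
  have "odd (i + j - int a) \<or> odd (i' + j' - int a)"
  proof -
    have "i' = i - 1 \<and> j' = j \<or> i' = i + 1 \<and> j' = j \<or> i' = i \<and> j' = j - 1 \<or> i' = i \<and> j' = j + 1"
      using adj by (auto simp: pq arcs_ends_hopi_rectangle)
    then show ?thesis by presburger
  qed
  then show "\<exists>k \<in> {..<b} \<times> {..<a}.
      p \<in> diag a k \<and> q \<in> antidiag a k \<or> q \<in> diag a k \<and> p \<in> antidiag a k"
    using hopi_rectangle_adj_square adj adj' unfolding pq by blast
next
  interpret graph "hopi_rectangle a b" by (rule graph_hopi_rectangle)
  assume "\<exists>k \<in> {..<b} \<times> {..<a}.
      p \<in> diag a k \<and> q \<in> antidiag a k \<or> q \<in> diag a k \<and> p \<in> antidiag a k"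
  then show "p \<rightarrow>\<^bsub>hopi_rectangle a b\<^esub> q"
    using hopi_rectangle_square_adj arcs_ends_symmetric[OF sym_arcs] by blast
qed

theorem corollary15:
  fixes a b :: nat and l :: "nat \<Rightarrow> int \<times> int"
  assumes "a \<ge> 1" and "b \<ge> 1"
    and "vertex_labelling (hopi_rectangle a b) l"
  shows "min_rank (hopi_rectangle a b) l \<le> 2 * a * b \<and>
    max_nullity (hopi_rectangle a b) l \<ge> a + b"
proof -
  let ?G = "hopi_rectangle a b" and ?K = "{..<b} \<times> {..<a}"
  define n where "n = card (verts ?G)"
  \<comment> \<open>Each square contributes two outer products, the indicator of \<open>diag\<close>
    times that of \<open>antidiag\<close> and the transpose of this; the boolean selects one of
    them.\<close>
  define f :: "(nat \<times> nat) \<times> bool \<Rightarrow> nat \<Rightarrow> real" where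
    "f = (\<lambda>(k, c) i. of_bool (l i \<in> (if c then diag a k else antidiag a k)))"
  define g :: "(nat \<times> nat) \<times> bool \<Rightarrow> nat \<Rightarrow> real" where
    "g = (\<lambda>(k, c). f (k, \<not> c))"
  define A where "A = mat n n (\<lambda>(i, j). \<Sum>k\<in>?K \<times> UNIV. f k i * g k j)"
  have A: "A \<in> carrier_mat n n" by (simp add: A_def)
  have entry: "(\<Sum>k\<in>?K \<times> UNIV. f k i * g k j) = (\<Sum>k\<in>?K. f (k, True) i * f (k, False) j
      + f (k, True) j * f (k, False) i)" for i j
    by (simp add: sum.cartesian_product' UNIV_bool g_def algebra_simps)
  have "transpose_mat A = A"
    by (rule eq_matI) (auto simp: A_def entry add.commute)
  moreover have "A $$ (i, j) \<noteq> 0 \<longleftrightarrow> l i \<rightarrow>\<^bsub>?G\<^esub> l j" if "i < n" "j < n" for i j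
  proof -
    \<comment> \<open>All summands are nonnegative, so nothing cancels and an entry vanishes only if
      every term does.\<close>
    have "A $$ (i, j) \<noteq> 0 \<longleftrightarrow> (\<exists>k\<in>?K. l i \<in> diag a k \<and> l j \<in> antidiag a k \<or>
        l j \<in> diag a k \<and> l i \<in> antidiag a k)"
      using that unfolding A_def
      by (simp only: index_mat entry case_prod_conv, subst sum_nonneg_eq_0_iff)
        (auto simp: f_def add_nonneg_eq_0_iff)
    also have "\<dots> \<longleftrightarrow> l i \<rightarrow>\<^bsub>?G\<^esub> l j"
      by (rule hopi_rectangle_adj_iff_square[symmetric])
    finally show ?thesis .
  qed
  ultimately have mem: "A \<in> sym_matrices ?G l"
    using A by (simp add: sym_matrices_def n_def)
  have "vec_space.rank n A \<le> card (?K \<times> (UNIV :: bool set))"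
    unfolding A_def by (rule vec_space.rank_sum_products_le) simp
  then have rank: "vec_space.rank n A \<le> 2 * a * b"
    by (simp add: card_cartesian_product algebra_simps)
  have "vec_space.rank n A + kernel_dim A = n"
    by (rule vec_space.rank_plus_kernel_dim[OF A])
  with rank have nullity: "a + b \<le> kernel_dim A"
    by (simp add: n_def card_verts_hopi_rectangle)
  have "min_rank ?G l \<le> vec_space.rank n A"
    unfolding min_rank_def n_def[symmetric]
    using mem by (intro Min_le finite_ranks[of ?G l, folded n_def]) auto
  moreover have "kernel_dim A \<le> max_nullity ?G l"
    unfolding max_nullity_def using mem by (intro Max_ge finite_nullities) auto
  ultimately show ?thesis using rank nullity by simp
qed

end
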